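(* Let $f:\mathcal U_f\to\mathbb L^3$ be a cuspidal edge along a regular curve $\Gamma:I\to\mathbb L^3$. If the mean curvature $H^L$ of $f$ is bounded on $\mathcal U_f\setminus\Sigma_f$, then $\Gamma$ is of type $L$, i.e. $\Gamma'(s)$ is a light-like vector for every $s\in I$.
   Context: $\mathbb L^3$ is $\mathbb R^3$ with $\langle a,b\rangle_L=a_1b_1+a_2b_2-a_3b_3$; a vector $a\ne0$ is light-like if $\langle a,a\rangle_L=0$. $I$ is an open interval, $\delta>0$. A generalized cuspidal edge along $\Gamma$ is a $C^\infty$-map $f:\mathcal U_f=I\times(-\delta,\delta)\to\mathbb R^3$ with $\Gamma(s)=f(s,0)$ a regular curve, $f_t(s,0)=0$, and $f_{tt}(s,0),\Gamma'(s)$ linearly independent for all $s\in I$; $\Sigma_f=\{(s,0):s\in I\}$. A point $(s,0)$ is a cuspidal edge singular point if near it $f$ is equivalent to $(s,t)\mapsto(s,t^2,t^3)$ at the origin under local diffeomorphisms of source and target. A cuspidal edge along $\Gamma$ is a $C^\infty$-map $f:\mathcal U_f=I\times(-\delta,\delta)\to\mathbb R^3$, with $f(s,0)=\Gamma(s)$ a regular curve, all of whose points $(s,0)$, $s\in I$, are cuspidal edge singular points (it is then a generalized cuspidal edge, with coordinates chosen so that $f_t(s,0)=0$). With $E^L=\langle f_s,f_s\rangle_L$, $F^L=\langle f_s,f_t\rangle_L$, $G^L=\langle f_t,f_t\rangle_L$, $\Delta_L=E^LG^L-(F^L)^2$, $\tilde L=\det(f_s,f_t,f_{ss})$, $\tilde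 M=\det(f_s,f_t,f_{st})$, $\tilde N=\det(f_s,f_t,f_{tt})$, the mean curvature is $H^L=\frac{E^L\tilde N-2F^L\tilde M+G^L\tilde L}{2\Delta_L\sqrt{|\Delta_L|}}$, defined at regular points with $\Delta_L\ne0$; boundedness refers to these points. *)

theory Defs
  imports "HOL-Analysis.Analysis"
begin

primrec diff_on_order ::
  "nat \<Rightarrow> 'a::euclidean_space set \<Rightarrow> ('a \<Rightarrow> 'b::euclidean_space) \<Rightarrow> bool" where
  "diff_on_order 0 S f \<longleftrightarrow> continuous_on S f"
| "diff_on_order (Suc k) S f \<longleftrightarrow>
     (\<forall>x\<in>S. f differentiable (at x)) \<and>
     (\<forall>v. diff_on_order k S (\<lambda>x. frechet_derivative f (at x) v))"

text \<open>Class \<open>C\<^sup>\<infinity>\<close>; only meant for open sets, since derivatives are taken at \<open>at x\<close>.\<close>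

definition smooth_on :: "'a::euclidean_space set \<Rightarrow> ('a \<Rightarrow> 'b::euclidean_space) \<Rightarrow> bool" where
  "smooth_on S f \<longleftrightarrow> (\<forall>k. diff_on_order k S f)"

definition diffeomorphism_between ::
  "'a::euclidean_space set \<Rightarrow> 'b::euclidean_space set \<Rightarrow> ('a \<Rightarrow> 'b) \<Rightarrow> bool" where
  "diffeomorphism_between V V' \<phi> \<longleftrightarrow> open V \<and> open V' \<and>
     (\<exists>\<psi>. homeomorphism V V' \<phi> \<psi> \<and> smooth_on V \<phi> \<and> smooth_on V' \<psi>)"

definition lorentz :: "real^3 \<Rightarrow> real^3 \<Rightarrow> real" where
  "lorentz a b = a$1 * b$1 + a$2 * b$2 - a$3 * b$3"

definition light_like :: "real^3 \<Rightarrow> bool" where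
  "light_like a \<longleftrightarrow> a \<noteq> 0 \<and> lorentz a a = 0"

definition regular_curve_on :: "real set \<Rightarrow> (real \<Rightarrow> real^3) \<Rightarrow> bool" where
  "regular_curve_on I \<Gamma> \<longleftrightarrow> smooth_on I \<Gamma> \<and> (\<forall>s\<in>I. vector_derivative \<Gamma> (at s) \<noteq> 0)"

definition type_L_on :: "real set \<Rightarrow> (real \<Rightarrow> real^3) \<Rightarrow> bool" where
  "type_L_on I \<Gamma> \<longleftrightarrow> (\<forall>s\<in>I. light_like (vector_derivative \<Gamma> (at s)))"

definition strip :: "real set \<Rightarrow> real \<Rightarrow> (real \<times> real) set" where
  "strip I \<delta> = I \<times> {-\<delta><..<\<delta>}"

definition sing_axis :: "real set \<Rightarrow> (real \<times> real) set" where
  "sing_axis I = I \<times> {0}"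

definition standard_cuspidal_edge :: "real \<times> real \<Rightarrow> real^3" where
  "standard_cuspidal_edge = (\<lambda>(s, t). vector [s, t^2, t^3])"

definition cuspidal_edge_point ::
  "(real \<times> real) set \<Rightarrow> (real \<times> real \<Rightarrow> real^3) \<Rightarrow> real \<times> real \<Rightarrow> bool" where
  "cuspidal_edge_point U f p \<longleftrightarrow>
     (\<exists>V V' \<phi> W W' \<Psi>.
        p \<in> V \<and> V \<subseteq> U \<and> diffeomorphism_between V V' \<phi> \<and> \<phi> p = (0, 0) \<and>
        f ` V \<subseteq> W \<and> diffeomorphism_between W W' \<Psi> \<and> \<Psi> (f p) = 0 \<and>
        (\<forall>q\<in>V. \<Psi> (f q) = standard_cuspidal_edge (\<phi> q)))"

text \<open>The normalisation \<open>f\<^sub>t(s,0) = 0\<close> of the coordinates is not required; it can be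
  attained by a local change of coordinates preserving the axis \<open>t = 0\<close> pointwise.\<close>

definition cuspidal_edge_along ::
  "real set \<Rightarrow> real \<Rightarrow> (real \<times> real \<Rightarrow> real^3) \<Rightarrow> (real \<Rightarrow> real^3) \<Rightarrow> bool" where
  "cuspidal_edge_along I \<delta> f \<Gamma> \<longleftrightarrow>
     smooth_on (strip I \<delta>) f \<and>
     (\<forall>s\<in>I. f (s, 0) = \<Gamma> s) \<and>
     regular_curve_on I \<Gamma> \<and>
     (\<forall>s\<in>I. cuspidal_edge_point (strip I \<delta>) f (s, 0))"

definition partial_s ::
  "(real \<times> real \<Rightarrow> 'a::real_normed_vector) \<Rightarrow> real \<times> real \<Rightarrow> 'a" where
  "partial_s f = (\<lambda>(s, t). vector_derivative (\<lambda>x. f (x, t)) (at s))"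

definition partial_t ::
  "(real \<times> real \<Rightarrow> 'a::real_normed_vector) \<Rightarrow> real \<times> real \<Rightarrow> 'a" where
  "partial_t f = (\<lambda>(s, t). vector_derivative (\<lambda>y. f (s, y)) (at t))"

definition regular_point :: "(real \<times> real \<Rightarrow> real^3) \<Rightarrow> real \<times> real \<Rightarrow> bool" where
  "regular_point f p \<longleftrightarrow>
     (\<forall>a b. a *\<^sub>R partial_s f p + b *\<^sub>R partial_t f p = 0 \<longrightarrow> a = 0 \<and> b = 0)"

definition E_L :: "(real \<times> real \<Rightarrow> real^3) \<Rightarrow> real \<times> real \<Rightarrow> real" where
  "E_L f p = lorentz (partial_s f p) (partial_s f p)"

definition F_L :: "(real \<times> real \<Rightarrow> real^3) \<Rightarrow> real \<times> real \<Rightarrow> real" where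
  "F_L f p = lorentz (partial_s f p) (partial_t f p)"

definition G_L :: "(real \<times> real \<Rightarrow> real^3) \<Rightarrow> real \<times> real \<Rightarrow> real" where
  "G_L f p = lorentz (partial_t f p) (partial_t f p)"

definition Delta_L :: "(real \<times> real \<Rightarrow> real^3) \<Rightarrow> real \<times> real \<Rightarrow> real" where
  "Delta_L f p = E_L f p * G_L f p - (F_L f p)^2"

definition det3 :: "real^3 \<Rightarrow> real^3 \<Rightarrow> real^3 \<Rightarrow> real" where
  "det3 a b c = det (vector [a, b, c] :: real^3^3)"

definition L_tilde :: "(real \<times> real \<Rightarrow> real^3) \<Rightarrow> real \<times> real \<Rightarrow> real" where
  "L_tilde f p = det3 (partial_s f p) (partial_t f p) (partial_s (partial_s f) p)"

definition M_tilde :: "(real \<times> real \<Rightarrow> real^3) \<Rightarrow> real \<times> real \<Rightarrow> real" where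
  "M_tilde f p = det3 (partial_s f p) (partial_t f p) (partial_t (partial_s f) p)"

definition N_tilde :: "(real \<times> real \<Rightarrow> real^3) \<Rightarrow> real \<times> real \<Rightarrow> real" where
  "N_tilde f p = det3 (partial_s f p) (partial_t f p) (partial_t (partial_t f) p)"

definition mean_curvature_L :: "(real \<times> real \<Rightarrow> real^3) \<Rightarrow> real \<times> real \<Rightarrow> real" where
  "mean_curvature_L f p =
     (E_L f p * N_tilde f p - 2 * F_L f p * M_tilde f p + G_L f p * L_tilde f p) /
     (2 * Delta_L f p * sqrt \<bar>Delta_L f p\<bar>)"

definition mean_curvature_L_bounded_on ::
  "(real \<times> real \<Rightarrow> real^3) \<Rightarrow> (real \<times> real) set \<Rightarrow> bool" where
  "mean_curvature_L_bounded_on f S \<longleftrightarrow>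
     bounded (mean_curvature_L f ` {p \<in> S. regular_point f p \<and> Delta_L f p \<noteq> 0})"

end

theory Submission
  imports Defs
begin

text \<open>Suppose that \<open>\<Gamma>'(s)\<close> is not light-like. Near \<open>(s, 0)\<close> the surface is
  \<open>f = \<Theta> \<circ> \<sigma> \<circ> \<phi>\<close>, where \<open>\<sigma>(u, v) = (u, v\<^sup>2, v\<^sup>3)\<close> and \<open>\<Theta>\<close>, \<open>\<phi>\<close> are diffeomorphisms. Up to sign
  the mean curvature does not see \<open>\<phi>\<close> (\<open>gram_H_numerator_reparametrize\<close>), so it may be computed
  for \<open>g = \<Theta> \<circ> \<sigma>\<close>. Since \<open>g\<^sub>v\<close> is divisible by \<open>v\<close>, both the discriminant and the numerator of
  \<open>H\<^sup>L\<close> are divisible by \<open>v\<^sup>2\<close>: they equal \<open>v\<^sup>2 d\<close> and \<open>v\<^sup>2 \<kappa>\<close> with \<open>d\<close>, \<open>\<kappa>\<close> continuous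
  (\<open>cuspidal_model_expansion\<close>). Here \<open>\<kappa>(0,0)\<close> is six times the Jacobian determinant of \<open>\<Theta>\<close> at 0 times
  \<open>\<langle>g\<^sub>u, g\<^sub>u\<rangle>\<^sub>L\<close>, and \<open>\<Gamma>'(s)\<close> is a multiple of \<open>g\<^sub>u(0,0)\<close>; hence \<open>\<kappa>(0,0) \<noteq> 0\<close>. Where \<open>H\<^sup>L\<close> is
  defined, \<open>\<bar>H\<^sup>L\<bar> = \<bar>\<kappa>\<bar> / (2 \<bar>v\<bar> \<bar>d\<bar> sqrt \<bar>d\<bar>)\<close>, which exceeds every
  bound near \<open>(0,0)\<close>, because \<open>\<kappa>\<close> stays away from 0 there, \<open>d\<close> is bounded and \<open>v\<close> tends to 0.

  It remains to see that \<open>H\<^sup>L\<close> is defined at points arbitrarily close to \<open>(s, 0)\<close>. Otherwise the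
  induced metric would degenerate on an open set. In a surface with degenerate metric the
  integral curves of the null direction are pregeodesics, so the second fundamental form vanishes on
  that direction; this says that the numerator of \<open>H\<^sup>L\<close> vanishes there
  (\<open>null_surface_H_numerator\<close>). But the numerator is \<open>v\<^sup>2 \<kappa>\<close> up to a
  nonzero factor, and for \<open>v \<noteq> 0\<close> near the origin this is not 0.\<close>

section \<open>Second-order jets\<close>

text \<open>The derivatives are explicit arguments, so that the chain rule yields
  formulas for them; \<open>F2 x v w\<close> is the derivative of \<open>\<lambda>x. F x v\<close> in the direction \<open>w\<close>. No symmetry
  is built in: it is a consequence of the continuity of \<open>F2\<close>.\<close>

definition jet2 ::
  "'a::euclidean_space set \<Rightarrow> ('a \<Rightarrow> 'b::euclidean_space) \<Rightarrow> ('a \<Rightarrow> 'a \<Rightarrow> 'b)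
    \<Rightarrow> ('a \<Rightarrow> 'a \<Rightarrow> 'a \<Rightarrow> 'b) \<Rightarrow> bool" where
  "jet2 S f F F2 \<longleftrightarrow> open S \<and> (\<forall>x\<in>S. (f has_derivative F x) (at x))
    \<and> (\<forall>x\<in>S. \<forall>v. ((\<lambda>x. F x v) has_derivative F2 x v) (at x))
    \<and> (\<forall>v w. continuous_on S (\<lambda>x. F2 x v w))"

lemma jet2D:
  assumes "jet2 S f F F2"
  shows jet2_open: "open S"
    and jet2_has_derivative: "x \<in> S \<Longrightarrow> (f has_derivative F x) (at x)"
    and jet2_has_derivative2: "x \<in> S \<Longrightarrow> ((\<lambda>x. F x v) has_derivative F2 x v) (at x)"
    and jet2_continuous2: "continuous_on S (\<lambda>x. F2 x v w)"
    and jet2_continuous1: "continuous_on S (\<lambda>x. F x v)"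
    and jet2_continuous: "continuous_on S f"
    and jet2_linear: "x \<in> S \<Longrightarrow> linear (F x)"
    and jet2_linear2: "x \<in> S \<Longrightarrow> linear (F2 x v)"
proof -
  show o: "open S" and d: "\<And>x. x \<in> S \<Longrightarrow> (f has_derivative F x) (at x)"
    and d2: "\<And>x v. x \<in> S \<Longrightarrow> ((\<lambda>x. F x v) has_derivative F2 x v) (at x)"
    and "continuous_on S (\<lambda>x. F2 x v w)"
    using assms unfolding jet2_def by blast+
  show "continuous_on S (\<lambda>x. F x v)"
    by (rule has_derivative_continuous_on[OF has_derivative_at_withinI[OF d2]])
  show "continuous_on S f"
    by (rule has_derivative_continuous_on[OF has_derivative_at_withinI[OF d]])
  show "linear (F x)" if "x \<in> S" by (rule has_derivative_linear[OF d[OF that]])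
  show "linear (F2 x v)" if "x \<in> S" by (rule has_derivative_linear[OF d2[OF that]])
qed

lemma jet2_of_smooth:
  fixes f :: "'a::euclidean_space \<Rightarrow> 'b::euclidean_space"
  assumes "open S" "smooth_on S f"
  obtains F F2 where "jet2 S f F F2"
proof -
  define F where "F = (\<lambda>x. frechet_derivative f (at x))"
  define F2 where "F2 = (\<lambda>x v. frechet_derivative (\<lambda>x. F x v) (at x))"
  have "diff_on_order (Suc (Suc 0)) S f"
    using assms by (auto simp: smooth_on_def simp del: diff_on_order.simps)
  then have "jet2 S f F F2"
    using assms(1) unfolding jet2_def F_def F2_def
    by (auto simp: frechet_derivative_works[symmetric])
  then show ?thesis by (rule that)
qed

lemma linear_expand:
  fixes L :: "'a::euclidean_space \<Rightarrow> 'b::real_vector"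
  assumes "linear L"
  shows "L v = (\<Sum>b\<in>Basis. (v \<bullet> b) *\<^sub>R L b)"
proof -
  have "L v = L (\<Sum>b\<in>Basis. (v \<bullet> b) *\<^sub>R b)" by (simp only: euclidean_representation)
  then show ?thesis by (simp only: linear_sum[OF assms] linear_cmul[OF assms])
qed

lemma jet2_linear_first:
  fixes f :: "'a::euclidean_space \<Rightarrow> 'b::euclidean_space"
  assumes f: "jet2 S f F F2" and x: "x \<in> S"
  shows "F2 x v w = (\<Sum>b\<in>Basis. (v \<bullet> b) *\<^sub>R F2 x b w)"
proof -
  have "((\<lambda>y. \<Sum>b\<in>Basis. (v \<bullet> b) *\<^sub>R F y b) has_derivative (\<lambda>w. \<Sum>b\<in>Basis. (v \<bullet> b) *\<^sub>R F2 x b w)) (at x)"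
    by (intro has_derivative_sum has_derivative_scaleR_right jet2_has_derivative2[OF f x])
  then have "((\<lambda>y. F y v) has_derivative (\<lambda>w. \<Sum>b\<in>Basis. (v \<bullet> b) *\<^sub>R F2 x b w)) (at x)"
    by (rule has_derivative_transform_within_open[OF _ jet2_open[OF f] x])
       (rule linear_expand[symmetric], rule jet2_linear[OF f])
  from has_derivative_unique[OF jet2_has_derivative2[OF f x] this] show ?thesis by (rule fun_cong)
qed

lemma jet2_chain:
  fixes f :: "'a::euclidean_space \<Rightarrow> 'b::euclidean_space" and g :: "'b \<Rightarrow> 'c::euclidean_space"
  assumes f: "jet2 S f F F2" and g: "jet2 T g G G2" and sub: "\<And>x. x \<in> S \<Longrightarrow> f x \<in> T"
  shows "jet2 S (\<lambda>x. g (f x)) (\<lambda>x v. G (f x) (F x v))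
           (\<lambda>x v w. G2 (f x) (F x v) (F x w) + G (f x) (F2 x v w))"
proof -
  have comp: "((\<lambda>x. h (f x)) has_derivative (\<lambda>w. H (F x w))) (at x)"
    if "x \<in> S" "(h has_derivative H) (at (f x))" for h :: "'b \<Rightarrow> 'c" and H x
    by (rule has_derivative_compose[OF jet2_has_derivative[OF f that(1)] that(2)])
  have G: "G (f x) u = (\<Sum>b\<in>Basis. (u \<bullet> b) *\<^sub>R G (f x) b)" if "x \<in> S" for x u
    by (rule linear_expand[OF jet2_linear[OF g sub[OF that]]])
  have G2: "G2 (f x) u u' = (\<Sum>b\<in>Basis. \<Sum>b'\<in>Basis. ((u \<bullet> b) * (u' \<bullet> b')) *\<^sub>R G2 (f x) b b'
      )" if "x \<in> S" for x u u'
    by (subst jet2_linear_first[OF g sub[OF that]],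
        subst linear_expand[OF jet2_linear2[OF g sub[OF that]], of _ u'])
       (simp add: scaleR_sum_right)
  have der: "((\<lambda>x. G (f x) (F x v)) has_derivative
          (\<lambda>w. G2 (f x) (F x v) (F x w) + G (f x) (F2 x v w))) (at x)" if x: "x \<in> S" for x v
  proof -
    have "((\<lambda>x. \<Sum>b\<in>Basis. (F x v \<bullet> b) *\<^sub>R G (f x) b) has_derivative
       (\<lambda>w. \<Sum>b\<in>Basis. (F x v \<bullet> b) *\<^sub>R G2 (f x) b (F x w) + (F2 x v w \<bullet> b) *\<^sub>R G (f x) b)) (at x)"
      by (intro has_derivative_sum has_derivative_scaleR has_derivative_inner_left
           jet2_has_derivative2[OF f x] comp[OF x] jet2_has_derivative2[OF g sub[OF x]])
    also have "(\<lambda>w. \<Sum>b\<in>Basis. (F x v \<bullet> b) *\<^sub>R G2 (f x) b (F x w) + (F2 x v w \<bullet> b) *\<^sub>R G (f x) b)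
      = (\<lambda>w. G2 (f x) (F x v) (F x w) + G (f x) (F2 x v w))"
      by (simp add: sum.distrib G[OF x, symmetric] jet2_linear_first[OF g sub[OF x], symmetric])
    finally show ?thesis
      by (rule has_derivative_transform_within_open[OF _ jet2_open[OF f] x]) (rule G[symmetric])
  qed
  have cont: "continuous_on S (\<lambda>x. h (f x))" if "continuous_on T h" for h :: "'b \<Rightarrow> 'c"
    by (rule continuous_on_compose2[OF that jet2_continuous[OF f]]) (use sub in auto)
  have "continuous_on S (\<lambda>x. G2 (f x) (F x v) (F x w) + G (f x) (F2 x v w))" for v w
  proof -
    have "continuous_on S (\<lambda>x. (\<Sum>b\<in>Basis. \<Sum>b'\<in>Basis. ((F x v \<bullet> b) * (F x w \<bullet> b')) *\<^sub>R G2 (f x) b b')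
        + (\<Sum>b\<in>Basis. (F2 x v w \<bullet> b) *\<^sub>R G (f x) b))"
      by (intro continuous_intros jet2D[OF f] cont jet2D[OF g])
    then show ?thesis by (rule continuous_on_eq) (simp add: G[symmetric] G2[symmetric])
  qed
  then show ?thesis
    unfolding jet2_def using der jet2_open[OF f] comp[OF _ jet2_has_derivative[OF g sub]] by simp
qed

text \<open>The mean value theorem is applied twice, first along \<open>v\<close> and then along \<open>w\<close>. The left-hand
  side of the equation is symmetric in \<open>v\<close> and \<open>w\<close>, which is why it yields the symmetry of the second
  derivative in the limit.\<close>

lemma second_difference_mvt:
  fixes f :: "'a::euclidean_space \<Rightarrow> real"
  assumes f: "jet2 S f F F2" and ball: "ball p r \<subseteq> S" and h: "h > 0" "h * (norm v + norm w) < r"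
  obtains x where "x \<in> ball p r"
    "f (p + h *\<^sub>R v + h *\<^sub>R w) - f (p + h *\<^sub>R v) - f (p + h *\<^sub>R w) + f p = h\<^sup>2 * F2 x v w"
proof -
  have in_ball: "p + (h * a) *\<^sub>R v + (h * b) *\<^sub>R w \<in> ball p r" if "0 \<le> a" "a \<le> 1" "0 \<le> b" "b \<le> 1" for a b
  proof -
    have "norm ((h * a) *\<^sub>R v + (h * b) *\<^sub>R w) \<le> h * a * norm v + h * b * norm w"
      using h that by (intro norm_triangle_le) (simp add: abs_mult)
    also have "\<dots> \<le> h * 1 * norm v + h * 1 * norm w"
      using h that by (intro add_mono mult_right_mono mult_left_mono) auto
    also have "\<dots> < r" using h by (simp add: algebra_simps)
    finally have "dist (p + ((h * a) *\<^sub>R v + (h * b) *\<^sub>R w)) p < r"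
      by (simp add: dist_norm)
    then show ?thesis by (simp add: dist_commute add.assoc)
  qed
  have in_S: "p + (h * a) *\<^sub>R v + (h * b) *\<^sub>R w \<in> S" if "0 \<le> a" "a \<le> 1" "0 \<le> b" "b \<le> 1" for a b
    using in_ball[OF that] ball by blast
  have d1: "((\<lambda>a. f (p + (h * a) *\<^sub>R v + (h * b) *\<^sub>R w)) has_derivative
      (\<lambda>y. F (p + (h * a) *\<^sub>R v + (h * b) *\<^sub>R w) ((h * y) *\<^sub>R v))) (at a within {0..1})"
    if "0 \<le> a" "a \<le> 1" "0 \<le> b" "b \<le> 1" for a b
    by (rule has_derivative_compose[where g = f
          and f = "\<lambda>a. p + (h * a) *\<^sub>R v + (h * b) *\<^sub>R w", OF _ jet2_has_derivative[OF f in_S[OF that]]])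
       (auto intro!: derivative_eq_intros)
  have d2: "((\<lambda>b. F (p + (h * a) *\<^sub>R v + (h * b) *\<^sub>R w) v) has_derivative
      (\<lambda>y. F2 (p + (h * a) *\<^sub>R v + (h * b) *\<^sub>R w) v ((h * y) *\<^sub>R w))) (at b within {0..1})"
    if "0 \<le> a" "a \<le> 1" "0 \<le> b" "b \<le> 1" for a b
    by (rule has_derivative_compose[where g = "\<lambda>x. F x v"
          and f = "\<lambda>b. p + (h * a) *\<^sub>R v + (h * b) *\<^sub>R w", OF _ jet2_has_derivative2[OF f in_S[OF that]]])
       (auto intro!: derivative_eq_intros)
  let ?q = "\<lambda>a b. p + (h * a) *\<^sub>R v + (h * b) *\<^sub>R w"
  have "\<exists>a\<in>{0<..<1}. (f (?q 1 1) - f (?q 1 0)) - (f (?q 0 1) - f (?q 0 0))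
      = F (?q a 1) ((h * (1 - 0)) *\<^sub>R v) - F (?q a 0) ((h * (1 - 0)) *\<^sub>R v)"
    by (rule mvt_simple[of 0 1 "\<lambda>a. f (?q a 1) - f (?q a 0)"
        "\<lambda>a y. F (?q a 1) ((h * y) *\<^sub>R v) - F (?q a 0) ((h * y) *\<^sub>R v)"])
       (use d1[of _ 1] d1[of _ 0] in \<open>auto intro!: has_derivative_diff\<close>)
  then obtain a where a: "0 < a" "a < 1" and
    fa: "(f (?q 1 1) - f (?q 1 0)) - (f (?q 0 1) - f (?q 0 0))
      = F (?q a 1) (h *\<^sub>R v) - F (?q a 0) (h *\<^sub>R v)" by auto
  have "\<exists>b\<in>{0<..<1}. F (?q a 1) v - F (?q a 0) v = F2 (?q a b) v ((h * (1 - 0)) *\<^sub>R w)"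
    by (rule mvt_simple[of 0 1 "\<lambda>b. F (?q a b) v" "\<lambda>b y. F2 (?q a b) v ((h * y) *\<^sub>R w)"])
       (use d2[of a] a in auto)
  then obtain b where b: "0 < b" "b < 1" and
    fb: "F (?q a 1) v - F (?q a 0) v = F2 (?q a b) v (h *\<^sub>R w)" by auto
  have "(f (?q 1 1) - f (?q 1 0)) - (f (?q 0 1) - f (?q 0 0)) = h * (F (?q a 1) v - F (?q a 0) v)"
    unfolding fa using a linear_cmul[OF jet2_linear[OF f in_S[of a 0]], of h v]
      linear_cmul[OF jet2_linear[OF f in_S[of a 1]], of h v] by (simp add: algebra_simps)
  also have "\<dots> = h\<^sup>2 * F2 (?q a b) v w"
    unfolding fb using a b in_S by (simp add: linear_cmul[OF jet2_linear2[OF f]] power2_eq_square)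
  finally show ?thesis
    using that[of "?q a b"] in_ball[of a b] a b by (simp add: algebra_simps)
qed

lemma jet2_symmetric_real:
  fixes f :: "'a::euclidean_space \<Rightarrow> real"
  assumes f: "jet2 S f F F2" and p: "p \<in> S"
  shows "F2 p v w = F2 p w v"
proof (rule ccontr)
  define e where "e = \<bar>F2 p v w - F2 p w v\<bar> / 2"
  assume "F2 p v w \<noteq> F2 p w v"
  then have e: "e > 0" by (simp add: e_def)
  have "\<forall>\<^sub>F x in at p. dist (F2 x u u') (F2 p u u') < e" for u u'
    using jet2_open[OF f] jet2_continuous2[OF f] p e
    by (intro tendstoD) (auto simp: continuous_on_eq_continuous_at isCont_def)
  then have "\<forall>\<^sub>F x in nhds p. x \<in> S \<and> dist (F2 x v w) (F2 p v w) < e \<and> dist (F2 x w v) (F2 p w v) < e"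
    using e by (intro eventually_conj eventually_nhds_in_open[OF jet2_open[OF f] p])
      (auto simp: eventually_nhds_conv_at)
  then obtain r where r: "r > 0" and near: "\<And>x. dist x p < r \<Longrightarrow> x \<in> S \<and>
      dist (F2 x v w) (F2 p v w) < e \<and> dist (F2 x w v) (F2 p w v) < e"
    unfolding eventually_nhds_metric by blast
  define h where "h = r / (2 * (norm v + norm w + 1))"
  have pos: "norm v + norm w + 1 > 0" by (smt (verit) norm_ge_zero)
  have h: "h > 0" "h * (norm v + norm w) < r" "h * (norm w + norm v) < r"
    using r pos by (auto simp: h_def field_simps) (smt (verit) mult_nonneg_nonneg norm_ge_zero)+
  have ball: "ball p r \<subseteq> S" using near by (auto simp: dist_commute)
  obtain x where x: "x \<in> ball p r" and
    fx: "f (p + h *\<^sub>R v + h *\<^sub>R w) - f (p + h *\<^sub>R v) - f (p + h *\<^sub>R w) + f p = h\<^sup>2 * F2 x v w"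
    using second_difference_mvt[OF f ball h(1,2)] by blast
  obtain y where y: "y \<in> ball p r" and
    fy: "f (p + h *\<^sub>R w + h *\<^sub>R v) - f (p + h *\<^sub>R w) - f (p + h *\<^sub>R v) + f p = h\<^sup>2 * F2 y w v"
    using second_difference_mvt[OF f ball h(1,3)] by blast
  have "h\<^sup>2 * F2 x v w = h\<^sup>2 * F2 y w v"
    unfolding fx[symmetric] fy[symmetric] by (simp add: algebra_simps)
  then have "F2 x v w = F2 y w v" using h by simp
  with near[of x] near[of y] x y show False
    by (auto simp: dist_real_def e_def dist_commute) (argo?)
qed

lemma jet2_symmetric:
  fixes f :: "'a::euclidean_space \<Rightarrow> 'b::euclidean_space"
  assumes f: "jet2 S f F F2" and p: "p \<in> S"
  shows "F2 p v w = F2 p w v"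
proof (rule euclidean_eqI)
  fix b :: 'b
  have "jet2 S (\<lambda>x. f x \<bullet> b) (\<lambda>x v. F x v \<bullet> b) (\<lambda>x v w. F2 x v w \<bullet> b)"
    using jet2D[OF f] unfolding jet2_def
    by (auto intro!: has_derivative_inner_left continuous_intros)
  from jet2_symmetric_real[OF this p] show "F2 p v w \<bullet> b = F2 p w v \<bullet> b" .
qed

lemma jet2_subset: "jet2 S f F F2 \<Longrightarrow> open T \<Longrightarrow> T \<subseteq> S \<Longrightarrow> jet2 T f F F2"
  unfolding jet2_def by (meson continuous_on_subset subsetD)

lemma jet2_cong:
  assumes f: "jet2 S f F F2" and eq: "\<And>x. x \<in> S \<Longrightarrow> f x = g x"
  shows "jet2 S g F F2"
  using f unfolding jet2_def
  by (auto intro: has_derivative_transform_within_open[where s = S] simp: eq)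

section \<open>Lorentzian algebra of a pair of vectors\<close>

text \<open>For tangent vectors \<open>x = f\<^sub>s\<close>, \<open>y = f\<^sub>t\<close> and second derivatives \<open>l = f\<^sub>s\<^sub>s\<close>, \<open>m = f\<^sub>s\<^sub>t\<close>,
  \<open>n = f\<^sub>t\<^sub>t\<close>, the next two expressions are \<open>\<Delta>\<^sub>L\<close> and the numerator of \<open>H\<^sup>L\<close>.\<close>

definition gram :: "real^3 \<Rightarrow> real^3 \<Rightarrow> real" where
  "gram x y = lorentz x x * lorentz y y - (lorentz x y)\<^sup>2"
definition H_numerator :: "real^3 \<Rightarrow> real^3 \<Rightarrow> real^3 \<Rightarrow> real^3 \<Rightarrow> real^3 \<Rightarrow> real" where
  "H_numerator x y l m n = lorentz x x * det3 x y n - 2 * lorentz x y * det3 x y m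
    + lorentz y y * det3 x y l"

lemma lorentz_commute: "lorentz a b = lorentz b a"
  by (simp add: lorentz_def mult.commute)

lemma det3_expand: "det3 a b c = a$1 * (b$2 * c$3 - b$3 * c$2) - a$2 * (b$1 * c$3 - b$3 * c$1)
   + a$3 * (b$1 * c$2 - b$2 * c$1)"
  unfolding det3_def det_3 by (simp add: vector_3 algebra_simps)

lemma gram_change:
  "gram (a *\<^sub>R x + c *\<^sub>R y) (b *\<^sub>R x + d *\<^sub>R y) = (a * d - b * c)\<^sup>2 * gram x y"
  (is "gram ?x ?y = _")
proof -
  have "lorentz ?x ?x = a^2 * lorentz x x + 2*a*c*lorentz x y + c^2 * lorentz y y"
    "lorentz ?y ?y = b^2 * lorentz x x + 2*b*d*lorentz x y + d^2 * lorentz y y"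
    "lorentz ?x ?y = a*b * lorentz x x + (a*d+b*c)*lorentz x y + c*d * lorentz y y"
    by (simp_all add: lorentz_def algebra_simps power2_eq_square)
  then show ?thesis unfolding gram_def by algebra
qed

lemma det3_change:
  "det3 (a *\<^sub>R x + c *\<^sub>R y) (b *\<^sub>R x + d *\<^sub>R y) (z + (h *\<^sub>R x + k *\<^sub>R y)) = (a*d - b*c) * det3 x y z"
  unfolding det3_expand by (simp, algebra)

text \<open>Second derivatives transform quadratically up to tangential terms, and the determinants
  annihilate those. The quadratic part contributes the square of the Jacobian, as it does for
  \<open>gram\<close>; the third factor comes from the determinants.\<close>

lemma H_numerator_change:
  assumes "l = a^2 *\<^sub>R L + (2*a*c) *\<^sub>R M + c^2 *\<^sub>R N + (h1 *\<^sub>R x + k1 *\<^sub>R y)"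
   and "m = (a*b) *\<^sub>R L + (a*d+b*c) *\<^sub>R M + (c*d) *\<^sub>R N + (h2 *\<^sub>R x + k2 *\<^sub>R y)"
   and "n = b^2 *\<^sub>R L + (2*b*d) *\<^sub>R M + d^2 *\<^sub>R N + (h3 *\<^sub>R x + k3 *\<^sub>R y)"
  shows "H_numerator (a *\<^sub>R x + c *\<^sub>R y) (b *\<^sub>R x + d *\<^sub>R y) l m n
    = (a * d - b * c)^3 * H_numerator x y L M N"
  (is "H_numerator ?x ?y _ _ _ = _")
proof -
  have 1: "lorentz ?x ?x = a^2 * lorentz x x + 2*a*c*lorentz x y + c^2 * lorentz y y"
    "lorentz ?y ?y = b^2 * lorentz x x + 2*b*d*lorentz x y + d^2 * lorentz y y"
    "lorentz ?x ?y = a*b * lorentz x x + (a*d+b*c)*lorentz x y + c*d * lorentz y y"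
    by (simp_all add: lorentz_def algebra_simps power2_eq_square)
  have lin: "det3 x y (p *\<^sub>R L + q *\<^sub>R M + r *\<^sub>R N)
      = p * det3 x y L + q * det3 x y M + r * det3 x y N" for p q r
    unfolding det3_expand by (simp, algebra)
  have 2: "det3 ?x ?y l = (a*d-b*c) * (a^2 * det3 x y L + (2*a*c) * det3 x y M + c^2 * det3 x y N)"
    "det3 ?x ?y m = (a*d-b*c) * ((a*b) * det3 x y L + (a*d+b*c) * det3 x y M + (c*d) * det3 x y N)"
    "det3 ?x ?y n = (a*d-b*c) * (b^2 * det3 x y L + (2*b*d) * det3 x y M + d^2 * det3 x y N)"
    unfolding assms det3_change lin by (rule refl)+
  show ?thesis unfolding H_numerator_def 1 2 by algebra
qed

text \<open>The Lorentz form is nondegenerate, so the orthogonal complement of \<open>X\<close> is a plane, which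
  contains all three vectors.\<close>

lemma det3_orthogonal_zero:
  assumes "lorentz x X = 0" "lorentz y X = 0" "lorentz z X = 0" "X \<noteq> 0"
  shows "det3 x y z = 0"
proof -
  have "det3 x y z * X$1 = 0" "det3 x y z * X$2 = 0" "det3 x y z * X$3 = 0"
    using assms(1-3) unfolding lorentz_def det3_expand by algebra+
  with assms(4) show ?thesis by (auto simp: vec_eq_iff forall_3)
qed

text \<open>The two differential hypotheses are half the derivatives of \<open>EG - F\<^sup>2\<close> along \<open>s\<close> and \<open>t\<close>.
  The null direction of the tangent plane is \<open>X = E y - F x\<close>, and \<open>Z\<close> is the second derivative of
  the surface along it. The hypotheses make \<open>Z\<close> orthogonal to \<open>X\<close>, hence tangent, because the
  tangent plane is the orthogonal complement of \<open>X\<close> (if \<open>X = 0\<close>, then \<open>x\<close> and \<open>y\<close> are dependent). On the other hand, \<open>F\<^sup>2 = EG\<close> turns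
  \<open>det3 x y Z\<close> into \<open>E\<close> times the numerator of the mean curvature.\<close>

lemma null_plane_H_numerator:
  assumes gram: "gram x y = 0" and E: "lorentz x x \<noteq> 0"
    and ds: "lorentz x l * lorentz y y + lorentz x x * lorentz y m
              - lorentz x y * (lorentz l y + lorentz x m) = 0"
    and dt: "lorentz x m * lorentz y y + lorentz x x * lorentz y n
              - lorentz x y * (lorentz m y + lorentz x n) = 0"
  shows "H_numerator x y l m n = 0"
proof -
  define E F G where EFG: "E = lorentz x x" "F = lorentz x y" "G = lorentz y y"
  define X where "X = E *\<^sub>R y - F *\<^sub>R x"
  define Z where "Z = (E^2) *\<^sub>R n - (2*E*F) *\<^sub>R m + (F^2) *\<^sub>R l"
  have EG: "E * G = F^2" using gram by (simp add: gram_def EFG)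
  have lX: "lorentz v X = E * lorentz y v - F * lorentz x v" for v
    by (simp add: X_def lorentz_def algebra_simps)
  note comm = lorentz_commute[of l y] lorentz_commute[of m y]
  have det: "det3 x y Z = E^2 * det3 x y n - 2*E*F * det3 x y m + F^2 * det3 x y l"
    unfolding Z_def det3_expand by (simp, algebra)
  have "E * H_numerator x y l m n = det3 x y Z"
    unfolding det H_numerator_def EFG[symmetric] using EG by algebra
  moreover have "det3 x y Z = 0"
  proof (cases "X = 0")
    case True
    have "E * det3 x y Z = det3 x (X + F *\<^sub>R x) Z" unfolding X_def det3_expand by (simp, algebra)
    also have "\<dots> = 0" unfolding True det3_expand by (simp add: algebra_simps)
    finally show ?thesis using E EFG by simp
  next
    case False
    have a: "lorentz x X = 0" "lorentz y X = 0"
      unfolding lX EFG(1)[symmetric] EFG(3)[symmetric] lorentz_commute[of y x]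
      using EG unfolding EFG(2)[symmetric] by (simp_all add: power2_eq_square)
    have lZ: "lorentz Z X = E^2 * lorentz n X - 2*E*F*lorentz m X + F^2 * lorentz l X"
      unfolding Z_def lorentz_def by (simp, algebra)
    have "E * lorentz Z X = 0"
      using ds dt EG unfolding lZ lX[of l] lX[of m] lX[of n] EFG[symmetric] comm by algebra
    then have "lorentz Z X = 0" using E EFG by simp
    with a False show ?thesis by (intro det3_orthogonal_zero)
  qed
  ultimately show ?thesis using E EFG by simp
qed

lemma bounded_bilinear_lorentz: "bounded_bilinear lorentz"
  unfolding bilinear_conv_bounded_bilinear[symmetric] bilinear_def
  by (auto intro!: linearI simp: lorentz_def algebra_simps)

lemma continuous_on_lorentz:
  "continuous_on S a \<Longrightarrow> continuous_on S b \<Longrightarrow> continuous_on S (\<lambda>x. lorentz (a x) (b x))"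
  by (rule bounded_bilinear.continuous_on[OF bounded_bilinear_lorentz])

lemma continuous_on_det3:
  "continuous_on S a \<Longrightarrow> continuous_on S b \<Longrightarrow> continuous_on S c
    \<Longrightarrow> continuous_on S (\<lambda>x. det3 (a x) (b x) (c x))"
  unfolding det3_expand by (intro continuous_intros)

section \<open>Mean curvature from the jet of a surface\<close>

text \<open>The symmetry of the second derivative is essential here: it identifies \<open>f\<^sub>s\<^sub>t\<close>, which occurs
  when \<open>E\<close> is differentiated, with \<open>f\<^sub>t\<^sub>s\<close>, which occurs when \<open>G\<close> is.\<close>

lemma null_surface_H_numerator:
  fixes f :: "real \<times> real \<Rightarrow> real^3"
  assumes f: "jet2 S f F F2" and p: "p \<in> S"
    and null: "\<And>x. x \<in> S \<Longrightarrow> gram (F x (1,0)) (F x (0,1)) = 0"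
    and E: "lorentz (F p (1,0)) (F p (1,0)) \<noteq> 0"
  shows "H_numerator (F p (1,0)) (F p (0,1))
      (F2 p (1,0) (1,0)) (F2 p (1,0) (0,1)) (F2 p (0,1) (0,1)) = 0"
proof -
  note der = bounded_bilinear.FDERIV[OF bounded_bilinear_lorentz
      jet2_has_derivative2[OF f p] jet2_has_derivative2[OF f p]]
  let ?x = "F p (1,0)" and ?y = "F p (0,1)"
  let ?dx = "F2 p (1,0)" and ?dy = "F2 p (0,1)"
  have "((\<lambda>x. gram (F x (1,0)) (F x (0,1))) has_derivative
      (\<lambda>w. 2 * (lorentz ?x (?dx w) * lorentz ?y ?y + lorentz ?x ?x * lorentz ?y (?dy w)
        - lorentz ?x ?y * (lorentz (?dx w) ?y + lorentz ?x (?dy w))))) (at p)"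
    unfolding gram_def
    by (rule derivative_eq_intros der refl)+
      (simp add: fun_eq_iff lorentz_commute[of "F2 p v w" "F p v" for v w] algebra_simps)
  moreover have "((\<lambda>x. gram (F x (1,0)) (F x (0,1))) has_derivative (\<lambda>w. 0)) (at p)"
    by (rule has_derivative_transform_within_open[OF has_derivative_const jet2_open[OF f] p])
      (simp add: null)
  ultimately have "(\<lambda>w. 2 * (lorentz ?x (?dx w) * lorentz ?y ?y + lorentz ?x ?x * lorentz ?y (?dy w)
        - lorentz ?x ?y * (lorentz (?dx w) ?y + lorentz ?x (?dy w)))) = (\<lambda>w. 0)"
    by (rule has_derivative_unique)
  from fun_cong[OF this, of "(1,0)"] fun_cong[OF this, of "(0,1)"]
  show ?thesis
    by (intro null_plane_H_numerator null p E)
       (simp_all add: jet2_symmetric[OF f p, of "(0,1)" "(1,0)"])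
qed

lemma partials_of_has_derivative:
  assumes "(f has_derivative D) (at p)"
  shows "partial_s f p = D (1,0)" "partial_t f p = D (0,1)"
proof -
  obtain s t where p: "p = (s, t)" by (cases p)
  have lin: "linear D" by (rule has_derivative_linear[OF assms])
  have "((\<lambda>x. (x, t)) has_derivative (\<lambda>h. (h, 0))) (at s)"
    "((\<lambda>y. (s, y)) has_derivative (\<lambda>h. (0, h))) (at t)"
    by (auto intro!: derivative_eq_intros)
  then have "((\<lambda>x. f (x, t)) has_derivative (\<lambda>h. D (h, 0))) (at s)"
    "((\<lambda>y. f (s, y)) has_derivative (\<lambda>h. D (0, h))) (at t)"
    using has_derivative_compose[where g = f and f = "\<lambda>x. (x, t)"]
      has_derivative_compose[where g = f and f = "\<lambda>y. (s, y)"] assms unfolding p by auto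
  moreover have "(\<lambda>h. D (h, 0)) = (\<lambda>h. h *\<^sub>R D (1, 0))" "(\<lambda>h. D (0, h)) = (\<lambda>h. h *\<^sub>R D (0, 1))"
    by (simp_all add: fun_eq_iff linear_cmul[OF lin, symmetric])
  ultimately show "partial_s f p = D (1,0)" "partial_t f p = D (0,1)"
    unfolding partial_s_def partial_t_def p
    by (auto simp: has_vector_derivative_def[symmetric] intro: vector_derivative_at)
qed

lemma geometry_of_jet2:
  assumes f: "jet2 S f F F2" and p: "p \<in> S"
  shows "Delta_L f p = gram (F p (1,0)) (F p (0,1))"
    and "mean_curvature_L f p = H_numerator (F p (1,0)) (F p (0,1))
      (F2 p (1,0) (1,0)) (F2 p (1,0) (0,1)) (F2 p (0,1) (0,1))
      / (2 * Delta_L f p * sqrt \<bar>Delta_L f p\<bar>)"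
    and "Delta_L f p \<noteq> 0 \<Longrightarrow> regular_point f p"
proof -
  have 1: "partial_s f x = F x (1,0)" "partial_t f x = F x (0,1)" if "x \<in> S" for x
    by (rule partials_of_has_derivative[OF jet2_has_derivative[OF f that]])+
  have d: "(partial_s f has_derivative F2 p (1,0)) (at p)" "(partial_t f has_derivative F2 p (0,1)) (at p)"
    by (rule has_derivative_transform_within_open[OF jet2_has_derivative2[OF f p] jet2_open[OF f] p],
        simp add: 1)+
  note 2 = partials_of_has_derivative[OF d(1)] partials_of_has_derivative[OF d(2)]
  show D: "Delta_L f p = gram (F p (1,0)) (F p (0,1))"
    unfolding Delta_L_def E_L_def F_L_def G_L_def gram_def 1[OF p] ..
  show "mean_curvature_L f p = H_numerator (F p (1,0)) (F p (0,1))
      (F2 p (1,0) (1,0)) (F2 p (1,0) (0,1)) (F2 p (0,1) (0,1))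
      / (2 * Delta_L f p * sqrt \<bar>Delta_L f p\<bar>)"
    unfolding mean_curvature_L_def E_L_def F_L_def G_L_def L_tilde_def M_tilde_def N_tilde_def
      H_numerator_def 1[OF p] 2 ..
  show "regular_point f p" if "Delta_L f p \<noteq> 0"
    unfolding regular_point_def 1[OF p]
  proof (intro allI impI)
    fix a b :: real
    let ?x = "F p (1,0)" and ?y = "F p (0,1)"
    assume 0: "a *\<^sub>R ?x + b *\<^sub>R ?y = 0"
    have "lorentz (a *\<^sub>R ?x + b *\<^sub>R ?y) ?x = a * lorentz ?x ?x + b * lorentz ?x ?y"
      "lorentz (a *\<^sub>R ?x + b *\<^sub>R ?y) ?y = a * lorentz ?x ?y + b * lorentz ?y ?y"
      by (simp_all add: lorentz_def algebra_simps)
    then have "a * lorentz ?x ?x + b * lorentz ?x ?y = 0" "a * lorentz ?x ?y + b * lorentz ?y ?y = 0"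
      unfolding 0 by (simp_all add: lorentz_def)
    then have "a * gram ?x ?y = 0" "b * gram ?x ?y = 0" unfolding gram_def by algebra+
    with that show "a = 0 \<and> b = 0" by (simp add: D)
  qed
qed

text \<open>The maps \<open>F\<close> and \<open>F2\<close> are the jet of \<open>g \<circ> \<phi>\<close> given by the chain rule, and \<open>J\<close> is the Jacobian
  of \<open>\<phi>\<close>. Since \<open>J\<^sup>3 / (J\<^sup>2 \<bar>J\<bar>)\<close> is \<open>1\<close> or \<open>-1\<close>, the mean curvature of a surface is invariant up to
  sign.\<close>

lemma gram_H_numerator_reparametrize:
  fixes g :: "real \<times> real \<Rightarrow> real^3" and \<phi> :: "real \<times> real \<Rightarrow> real \<times> real"
  assumes g: "jet2 U g G G2" and q: "\<phi> p \<in> U"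
    and F: "F = (\<lambda>x v. G (\<phi> x) (P x v))" "F2 = (\<lambda>x v w. G2 (\<phi> x) (P x v) (P x w) + G (\<phi> x) (P2 x v w))"
    and J: "J = fst (P p (1,0)) * snd (P p (0,1)) - fst (P p (0,1)) * snd (P p (1,0))"
  shows "gram (F p (1,0)) (F p (0,1)) = J\<^sup>2 * gram (G (\<phi> p) (1,0)) (G (\<phi> p) (0,1))"
    and "H_numerator (F p (1,0)) (F p (0,1))
      (F2 p (1,0) (1,0)) (F2 p (1,0) (0,1)) (F2 p (0,1) (0,1))
      = J ^ 3 * H_numerator (G (\<phi> p) (1,0)) (G (\<phi> p) (0,1))
          (G2 (\<phi> p) (1,0) (1,0)) (G2 (\<phi> p) (1,0) (0,1)) (G2 (\<phi> p) (0,1) (0,1))"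
proof -
  let ?q = "\<phi> p"
  have G: "G ?q v = fst v *\<^sub>R G ?q (1,0) + snd v *\<^sub>R G ?q (0,1)" for v
    by (subst linear_expand[OF jet2_linear[OF g q]])
      (simp add: Basis_prod_def sum.union_disjoint sum.reindex inj_on_def inner_prod_def)
  have G2r: "G2 ?q v w = fst w *\<^sub>R G2 ?q v (1,0) + snd w *\<^sub>R G2 ?q v (0,1)" for v w
    by (subst linear_expand[OF jet2_linear2[OF g q]])
      (simp add: Basis_prod_def sum.union_disjoint sum.reindex inj_on_def inner_prod_def)
  have G2: "G2 ?q v w = (fst v * fst w) *\<^sub>R G2 ?q (1,0) (1,0)
     + (fst v * snd w + snd v * fst w) *\<^sub>R G2 ?q (1,0) (0,1)
     + (snd v * snd w) *\<^sub>R G2 ?q (0,1) (0,1)" for v w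
    using G2r[of v w] G2r[of "(1,0)" v] G2r[of "(0,1)" v] jet2_symmetric[OF g q, of v "(1,0)"]
      jet2_symmetric[OF g q, of v "(0,1)"] jet2_symmetric[OF g q, of "(0,1)" "(1,0)"]
    by (simp add: algebra_simps)
  show "gram (F p (1,0)) (F p (0,1)) = J\<^sup>2 * gram (G ?q (1,0)) (G ?q (0,1))"
    unfolding F J G[of "P p (1,0)"] G[of "P p (0,1)"] by (rule gram_change)
  show "H_numerator (F p (1,0)) (F p (0,1))
      (F2 p (1,0) (1,0)) (F2 p (1,0) (0,1)) (F2 p (0,1) (0,1))
      = J ^ 3 * H_numerator (G (\<phi> p) (1,0)) (G (\<phi> p) (0,1))
          (G2 (\<phi> p) (1,0) (1,0)) (G2 (\<phi> p) (1,0) (0,1)) (G2 (\<phi> p) (0,1) (0,1))"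
    unfolding F J G[of "P p (1,0)"] G[of "P p (0,1)"] G[of "P2 p _ _"]
    by (rule H_numerator_change) (simp_all add: G2[of "P p _"] power2_eq_square algebra_simps)
qed

section \<open>The standard cuspidal edge in a curved chart\<close>

abbreviation axis1 :: "real^3" where "axis1 \<equiv> axis 1 1"
abbreviation axis2 :: "real^3" where "axis2 \<equiv> axis 2 1"
abbreviation axis3 :: "real^3" where "axis3 \<equiv> axis 3 1"

lemma standard_cuspidal_edge_axis:
  "standard_cuspidal_edge q = fst q *\<^sub>R axis1 + (snd q)\<^sup>2 *\<^sub>R axis2 + (snd q)^3 *\<^sub>R axis3"
  by (simp add: standard_cuspidal_edge_def case_prod_beta vec_eq_iff forall_3 axis_def)

lemma jet2_standard_cuspidal_edge:
  "jet2 UNIV standard_cuspidal_edge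
    (\<lambda>q w. fst w *\<^sub>R axis1 + (2 * snd q * snd w) *\<^sub>R axis2 + (3 * (snd q)\<^sup>2 * snd w) *\<^sub>R axis3)
    (\<lambda>q w z. (2 * snd w * snd z) *\<^sub>R axis2 + (6 * snd q * snd w * snd z) *\<^sub>R axis3)"
  unfolding jet2_def standard_cuspidal_edge_axis[abs_def]
  by (auto intro!: derivative_eq_intros continuous_intros simp: algebra_simps power2_eq_square)

lemma det3_images_nonzero:
  fixes T :: "real^3 \<Rightarrow> real^3"
  assumes "linear T" "linear S" "\<And>x. S (T x) = x"
  shows "det3 (T axis1) (T axis2) (T axis3) \<noteq> 0"
proof -
  have "matrix S ** matrix T = mat 1"
    using assms by (simp add: matrix_compose[symmetric] comp_def matrix_id_mat_1[unfolded id_def])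
  then have "det (matrix S) * det (matrix T) = 1" by (metis det_I det_mul)
  moreover have "(vector [T axis1, T axis2, T axis3] :: real^3^3) = transpose (matrix T)"
    by (simp add: vec_eq_iff forall_3 transpose_def matrix_def)
  ultimately show ?thesis unfolding det3_def by (auto simp: det_transpose)
qed

lemma jacobian_nonzero:
  fixes P :: "real \<times> real \<Rightarrow> real \<times> real"
  assumes "linear P" "linear Q" "\<And>x. Q (P x) = x"
  shows "fst (P (1,0)) * snd (P (0,1)) - fst (P (0,1)) * snd (P (1,0)) \<noteq> 0"
proof
  obtain a c b d where P: "P (1,0) = (a, c)" "P (0,1) = (b, d)" by (metis surj_pair)
  assume "fst (P (1,0)) * snd (P (0,1)) - fst (P (0,1)) * snd (P (1,0)) = 0"
  then have J: "a * d = b * c" by (simp add: P)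
  have Q: "Q (a, c) = (1,0)" "Q (b, d) = (0,1)" by (simp_all add: P[symmetric] assms)
  have "Q (d *\<^sub>R (a, c) - c *\<^sub>R (b, d)) = (d, - c)" "Q (a *\<^sub>R (b, d) - b *\<^sub>R (a, c)) = (- b, a)"
    by (simp_all only: linear_diff[OF assms(2)] linear_cmul[OF assms(2)] Q) simp_all
  moreover have "d *\<^sub>R (a, c) - c *\<^sub>R (b, d) = (0,0)" "a *\<^sub>R (b, d) - b *\<^sub>R (a, c) = (0,0)"
    using J by (simp_all add: zero_prod_def algebra_simps)
  moreover have Q0: "Q (0,0) = (0,0)" using linear_0[OF assms(2)] by (simp add: zero_prod_def)
  ultimately have "a = 0" "c = 0" by simp_all
  then show False using Q(1) Q0 by simp
qed

text \<open>The shape of the arguments is that of the derivatives of a surface whose \<open>v\<close>-derivative is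
  \<open>v *\<^sub>R h\<close>: then \<open>m\<close> is \<open>h\<^sub>u\<close> and \<open>n\<close> is \<open>h\<^sub>v\<close>.\<close>

lemma cuspidal_factor:
  "gram x (v *\<^sub>R h) = v\<^sup>2 * gram x h"
  "H_numerator x (v *\<^sub>R h) l (v *\<^sub>R m) (h + v *\<^sub>R n) = v\<^sup>2 *
      (lorentz x x * det3 x h n - 2 * v * lorentz x h * det3 x h m + v * lorentz h h * det3 x h l)"
proof -
  have 1: "lorentz (v *\<^sub>R h) (v *\<^sub>R h) = v\<^sup>2 * lorentz h h" "lorentz x (v *\<^sub>R h) = v * lorentz x h"
    by (simp_all add: lorentz_def algebra_simps power2_eq_square)
  have 2: "det3 x (v *\<^sub>R h) l = v * det3 x h l" "det3 x (v *\<^sub>R h) (v *\<^sub>R m) = v\<^sup>2 * det3 x h m"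
    "det3 x (v *\<^sub>R h) (h + v *\<^sub>R n) = v\<^sup>2 * det3 x h n"
    unfolding det3_expand by (simp_all, algebra+)
  show "gram x (v *\<^sub>R h) = v\<^sup>2 * gram x h" unfolding gram_def 1 by algebra
  show "H_numerator x (v *\<^sub>R h) l (v *\<^sub>R m) (h + v *\<^sub>R n) = v\<^sup>2 *
      (lorentz x x * det3 x h n - 2 * v * lorentz x h * det3 x h m + v * lorentz h h * det3 x h l)"
    unfolding H_numerator_def 1 2 by algebra
qed

text \<open>On the axis \<open>v = 0\<close> the vectors \<open>h\<close> and \<open>n\<close> of \<open>cuspidal_factor\<close> are \<open>2 \<Theta>\<^sub>2\<close> and
  \<open>3 \<Theta>\<^sub>3\<close>, so \<open>\<kappa>\<close> reduces there to \<open>6 \<langle>\<Theta>\<^sub>1, \<Theta>\<^sub>1\<rangle>\<^sub>L det(\<Theta>\<^sub>1, \<Theta>\<^sub>2, \<Theta>\<^sub>3)\<close>. The cubic term of the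
  standard cuspidal edge is what keeps this from vanishing.\<close>

lemma cuspidal_model_expansion:
  fixes \<Theta> :: "real^3 \<Rightarrow> real^3"
  assumes \<Theta>: "jet2 W \<Theta> T T2" and 0: "0 \<in> W"
    and det: "det3 (T 0 axis1) (T 0 axis2) (T 0 axis3) \<noteq> 0"
    and E: "lorentz (T 0 axis1) (T 0 axis1) \<noteq> 0"
  obtains U G G2 \<kappa> d where
    "jet2 U (\<lambda>q. \<Theta> (standard_cuspidal_edge q)) G G2" "U = {q. standard_cuspidal_edge q \<in> W}"
    "continuous_on U \<kappa>" "continuous_on U d" "\<kappa> (0,0) \<noteq> 0"
    "\<And>q. q \<in> U \<Longrightarrow> gram (G q (1,0)) (G q (0,1)) = (snd q)\<^sup>2 * d q"
    "\<And>q. q \<in> U \<Longrightarrow> H_numerator (G q (1,0)) (G q (0,1))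
        (G2 q (1,0) (1,0)) (G2 q (1,0) (0,1)) (G2 q (0,1) (0,1))
        = (snd q)\<^sup>2 * \<kappa> q"
proof -
  let ?\<sigma> = standard_cuspidal_edge
  define S where "S = (\<lambda>(q::real\<times>real) (w::real\<times>real).
     fst w *\<^sub>R axis1 + (2 * snd q * snd w) *\<^sub>R axis2 + (3 * (snd q)\<^sup>2 * snd w) *\<^sub>R axis3)"
  define S2 where "S2 = (\<lambda>(q::real\<times>real) (w::real\<times>real) (z::real\<times>real).
     (2 * snd w * snd z) *\<^sub>R axis2 + (6 * snd q * snd w * snd z) *\<^sub>R axis3)"
  have \<sigma>: "jet2 UNIV ?\<sigma> S S2" unfolding S_def S2_def by (rule jet2_standard_cuspidal_edge)
  define U where "U = {q. ?\<sigma> q \<in> W}"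
  have "open U"
    using open_vimage[OF jet2_open[OF \<Theta>], of ?\<sigma>] jet2_continuous[OF \<sigma>] by (simp add: U_def vimage_def)
  then have \<sigma>U: "jet2 U ?\<sigma> S S2" using jet2_subset[OF \<sigma>] by simp
  define G where "G = (\<lambda>q w. T (?\<sigma> q) (S q w))"
  define G2 where "G2 = (\<lambda>q w z. T2 (?\<sigma> q) (S q w) (S q z) + T (?\<sigma> q) (S2 q w z))"
  have g: "jet2 U (\<lambda>q. \<Theta> (?\<sigma> q)) G G2"
    unfolding G_def G2_def by (rule jet2_chain[OF \<sigma>U \<Theta>]) (simp add: U_def)
  define x where "x = (\<lambda>q. T (?\<sigma> q) axis1)"
  define h where "h = (\<lambda>q. 2 *\<^sub>R T (?\<sigma> q) axis2 + (3 * snd q) *\<^sub>R T (?\<sigma> q) axis3)"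
  define l where "l = (\<lambda>q. T2 (?\<sigma> q) axis1 axis1)"
  define m where "m = (\<lambda>q. 2 *\<^sub>R T2 (?\<sigma> q) axis1 axis2 + (3 * snd q) *\<^sub>R T2 (?\<sigma> q) axis1 axis3)"
  define n where "n = (\<lambda>q. snd q *\<^sub>R (4 *\<^sub>R T2 (?\<sigma> q) axis2 axis2 + (12 * snd q) *\<^sub>R T2 (?\<sigma> q) axis2 axis3
      + (9 * (snd q)\<^sup>2) *\<^sub>R T2 (?\<sigma> q) axis3 axis3) + 3 *\<^sub>R T (?\<sigma> q) axis3)"
  have G: "G q (1,0) = x q" "G q (0,1) = snd q *\<^sub>R h q"
    "G2 q (1,0) (1,0) = l q" "G2 q (1,0) (0,1) = snd q *\<^sub>R m q" "G2 q (0,1) (0,1) = h q + snd q *\<^sub>R n q"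
    if "q \<in> U" for q
  proof -
    have q: "?\<sigma> q \<in> W" using that by (simp add: U_def)
    note lT = jet2_linear[OF \<Theta> q] and lT2 = jet2_linear2[OF \<Theta> q]
    note lin = linear_add[OF lT] linear_cmul[OF lT] linear_add[OF lT2] linear_cmul[OF lT2] linear_0[OF lT]
    have sym: "T2 (?\<sigma> q) (a *\<^sub>R v + b *\<^sub>R w) z = a *\<^sub>R T2 (?\<sigma> q) v z + b *\<^sub>R T2 (?\<sigma> q) w z" for a b v w z
      by (simp add: jet2_symmetric[OF \<Theta> q, of _ z] lin)
    have c: "T2 (?\<sigma> q) axis3 axis2 = T2 (?\<sigma> q) axis2 axis3" by (rule jet2_symmetric[OF \<Theta> q])
    show "G q (1,0) = x q" "G q (0,1) = snd q *\<^sub>R h q" "G2 q (1,0) (1,0) = l q"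
      "G2 q (1,0) (0,1) = snd q *\<^sub>R m q" "G2 q (0,1) (0,1) = h q + snd q *\<^sub>R n q"
      unfolding G_def G2_def x_def h_def l_def m_def n_def S_def S2_def
      by (simp_all add: lin sym c vec_eq_iff algebra_simps power2_eq_square)
  qed
  have cont: "continuous_on U (\<lambda>q. k (?\<sigma> q))" if "continuous_on W k" for k :: "real^3 \<Rightarrow> real^3"
    by (rule continuous_on_compose2[OF that jet2_continuous[OF \<sigma>U]]) (auto simp: U_def)
  have conts: "continuous_on U x" "continuous_on U h" "continuous_on U l"
    "continuous_on U m" "continuous_on U n"
    unfolding x_def h_def l_def m_def n_def by (intro continuous_intros cont jet2D[OF \<Theta>])+
  define \<kappa> where "\<kappa> = (\<lambda>q. lorentz (x q) (x q) * det3 (x q) (h q) (n q)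
      - 2 * snd q * lorentz (x q) (h q) * det3 (x q) (h q) (m q)
      + snd q * lorentz (h q) (h q) * det3 (x q) (h q) (l q))"
  define d where "d = (\<lambda>q. gram (x q) (h q))"
  have \<sigma>0: "?\<sigma> (0,0) = 0" by (simp add: standard_cuspidal_edge_axis)
  show ?thesis
  proof (rule that[OF g U_def])
    show "continuous_on U \<kappa>" unfolding \<kappa>_def
      by (intro continuous_intros continuous_on_lorentz continuous_on_det3 conts)
    show "continuous_on U d" unfolding d_def gram_def
      by (intro continuous_intros continuous_on_lorentz conts)
    have "\<kappa> (0,0) = lorentz (T 0 axis1) (T 0 axis1) * (6 * det3 (T 0 axis1) (T 0 axis2) (T 0 axis3))"
      unfolding \<kappa>_def x_def h_def n_def \<sigma>0 det3_expand by (simp add: algebra_simps)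
    then show "\<kappa> (0,0) \<noteq> 0" using E det by simp
    show "gram (G q (1,0)) (G q (0,1)) = (snd q)\<^sup>2 * d q" if "q \<in> U" for q
      unfolding G[OF that] d_def by (rule cuspidal_factor)
    show "H_numerator (G q (1,0)) (G q (0,1))
        (G2 q (1,0) (1,0)) (G2 q (1,0) (0,1)) (G2 q (0,1) (0,1))
        = (snd q)\<^sup>2 * \<kappa> q" if "q \<in> U" for q
      unfolding G[OF that] \<kappa>_def by (rule cuspidal_factor)
  qed
qed

section \<open>Cuspidal edges with bounded mean curvature\<close>

lemma diffeomorphism_jets:
  fixes \<phi> :: "'a::euclidean_space \<Rightarrow> 'b::euclidean_space"
  assumes "diffeomorphism_between V V' \<phi>"
  obtains \<psi> P P2 Q Q2 where "homeomorphism V V' \<phi> \<psi>" "jet2 V \<phi> P P2" "jet2 V' \<psi> Q Q2"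
    "\<And>x v. x \<in> V \<Longrightarrow> Q (\<phi> x) (P x v) = v"
    "\<And>y v. y \<in> V' \<Longrightarrow> P (\<psi> y) (Q y v) = v"
proof -
  obtain \<psi> where o: "open V" "open V'" and h: "homeomorphism V V' \<phi> \<psi>"
    and sm: "smooth_on V \<phi>" "smooth_on V' \<psi>"
    using assms unfolding diffeomorphism_between_def by blast
  obtain P P2 Q Q2 where \<phi>: "jet2 V \<phi> P P2" and \<psi>: "jet2 V' \<psi> Q Q2"
    using jet2_of_smooth[OF o(1) sm(1)] jet2_of_smooth[OF o(2) sm(2)] by metis
  have inverse: "Q (\<phi> x) (P x v) = v"
    if \<phi>: "jet2 V \<phi> P P2" and \<psi>: "jet2 V' \<psi> Q Q2" and h: "homeomorphism V V' \<phi> \<psi>" and x: "x \<in> V"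
    for V :: "'c::euclidean_space set" and V' :: "'d::euclidean_space set" and \<phi> \<psi> P P2 Q Q2 x v
  proof -
    have "\<phi> x \<in> V'" using h x by (auto simp: homeomorphism_def)
    then have "((\<lambda>x. \<psi> (\<phi> x)) has_derivative (\<lambda>v. Q (\<phi> x) (P x v))) (at x)"
      by (rule has_derivative_compose[OF jet2_has_derivative[OF \<phi> x] jet2_has_derivative[OF \<psi>]])
    moreover have "((\<lambda>x. \<psi> (\<phi> x)) has_derivative (\<lambda>v. v)) (at x)"
      by (rule has_derivative_transform_within_open[OF has_derivative_ident jet2_open[OF \<phi>] x])
         (use h in \<open>simp add: homeomorphism_def\<close>)
    ultimately have "(\<lambda>v. Q (\<phi> x) (P x v)) = (\<lambda>v. v)" by (rule has_derivative_unique)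
    then show ?thesis by (rule fun_cong)
  qed
  show ?thesis
    using that[OF h \<phi> \<psi> inverse[OF \<phi> \<psi> h] inverse[OF \<psi> \<phi> homeomorphism_symD[OF h]]] by blast
qed

lemma open_meets_off_axis:
  fixes A :: "(real \<times> real) set"
  assumes "open A" "A \<noteq> {}"
  shows "\<exists>q\<in>A. snd q \<noteq> 0"
proof -
  obtain s t where st: "(s, t) \<in> A" using assms(2) by auto
  then obtain B C where BC: "open B" "open C" "s \<in> B" "t \<in> C" "B \<times> C \<subseteq> A"
    using assms(1) by (auto simp: open_prod_def)
  have "\<not> C \<subseteq> {0}" using BC(2,4) not_open_singleton by (metis empty_iff subset_singleton_iff)
  then obtain t' where "t' \<in> C" "t' \<noteq> 0" by blast
  with BC show ?thesis by force
qed

text \<open>The derivative of the standard cuspidal edge at the origin has rank one. Thus every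
  directional derivative of \<open>f\<close> at \<open>p0\<close> is a multiple of \<open>\<Theta>\<^sub>1(0)\<close>, and if the derivative along the
  first coordinate is not null, then neither is \<open>\<Theta>\<^sub>1(0)\<close>, so that \<open>cuspidal_model_expansion\<close>
  applies.\<close>

lemma null_direction_at_cuspidal_edge_point:
  fixes f :: "real \<times> real \<Rightarrow> real^3"
  assumes cusp: "cuspidal_edge_point U f p0"
    and bounded: "mean_curvature_L_bounded_on f {p \<in> U. snd p \<noteq> 0}"
  obtains D where "(f has_derivative D) (at p0)" "lorentz (D (1,0)) (D (1,0)) = 0"
proof -
  let ?\<sigma> = standard_cuspidal_edge
  obtain V V' \<phi> W W' \<Psi> where p0: "p0 \<in> V" and VU: "V \<subseteq> U" and diffeo: "diffeomorphism_between V V' \<phi>"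
    and \<phi>0: "\<phi> p0 = (0,0)" and fV: "f ` V \<subseteq> W" and diffeo': "diffeomorphism_between W W' \<Psi>"
    and \<Psi>0: "\<Psi> (f p0) = 0" and model: "\<And>q. q \<in> V \<Longrightarrow> \<Psi> (f q) = ?\<sigma> (\<phi> q)"
    using cusp unfolding cuspidal_edge_point_def by blast
  obtain \<psi> P P2 Q Q2 where h\<phi>: "homeomorphism V V' \<phi> \<psi>" and \<phi>: "jet2 V \<phi> P P2" and \<psi>: "jet2 V' \<psi> Q Q2"
    and QP: "\<And>x v. x \<in> V \<Longrightarrow> Q (\<phi> x) (P x v) = v"
    using diffeomorphism_jets[OF diffeo] by metis
  obtain \<Theta> R R2 T T2 where h\<Psi>: "homeomorphism W W' \<Psi> \<Theta>" and \<Psi>: "jet2 W \<Psi> R R2" and \<Theta>: "jet2 W' \<Theta> T T2"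
    and RT: "\<And>y v. y \<in> W' \<Longrightarrow> R (\<Theta> y) (T y v) = v"
    using diffeomorphism_jets[OF diffeo'] by metis
  have W': "\<Psi> (f q) \<in> W'" "\<Theta> (\<Psi> (f q)) = f q" if "q \<in> V" for q
    using that fV h\<Psi> by (auto simp: homeomorphism_def)
  have 0: "0 \<in> W'" using W'(1)[OF p0] \<Psi>0 by simp
  have \<Theta>0: "\<Theta> 0 \<in> W" using 0 h\<Psi> by (auto simp: homeomorphism_def)
  have det: "det3 (T 0 axis1) (T 0 axis2) (T 0 axis3) \<noteq> 0"
    by (rule det3_images_nonzero[OF jet2_linear[OF \<Theta> 0] jet2_linear[OF \<Psi> \<Theta>0] RT[OF 0]])
  define J where "J = (\<lambda>p. fst (P p (1,0)) * snd (P p (0,1)) - fst (P p (0,1)) * snd (P p (1,0)))"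
  have J: "J p \<noteq> 0" if "p \<in> V" for p
  proof -
    have "\<phi> p \<in> V'" using that h\<phi> by (auto simp: homeomorphism_def)
    from jacobian_nonzero[OF jet2_linear[OF \<phi> that] jet2_linear[OF \<psi> this] QP[OF that]]
    show ?thesis by (simp add: J_def)
  qed
  have d0: "(f has_derivative (\<lambda>v. fst (P p0 v) *\<^sub>R T 0 axis1)) (at p0)"
  proof -
    have "(?\<sigma> has_derivative (\<lambda>w. fst w *\<^sub>R axis1)) (at (\<phi> p0))"
      using jet2_has_derivative[OF jet2_standard_cuspidal_edge, of "(0,0)"] by (simp add: \<phi>0)
    then have s: "((\<lambda>p. ?\<sigma> (\<phi> p)) has_derivative (\<lambda>v. fst (P p0 v) *\<^sub>R axis1)) (at p0)"
      by (rule has_derivative_compose[OF jet2_has_derivative[OF \<phi> p0]])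
    have "(\<Theta> has_derivative T 0) (at (?\<sigma> (\<phi> p0)))"
      using jet2_has_derivative[OF \<Theta> 0] model[OF p0] \<Psi>0 by simp
    from has_derivative_compose[OF s this]
    have "((\<lambda>p. \<Theta> (?\<sigma> (\<phi> p))) has_derivative (\<lambda>v. fst (P p0 v) *\<^sub>R T 0 axis1)) (at p0)"
      by (simp add: linear_cmul[OF jet2_linear[OF \<Theta> 0]])
    then show ?thesis
      by (rule has_derivative_transform_within_open[OF _ jet2_open[OF \<phi>] p0])
         (simp add: model[symmetric] W')
  qed
  let ?a = "fst (P p0 (1,0))"
  have False if nz: "lorentz (?a *\<^sub>R T 0 axis1) (?a *\<^sub>R T 0 axis1) \<noteq> 0"
  proof -
    have "lorentz (T 0 axis1) (T 0 axis1) \<noteq> 0"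
      using nz by (auto simp: bounded_bilinear.scaleR_left[OF bounded_bilinear_lorentz]
          bounded_bilinear.scaleR_right[OF bounded_bilinear_lorentz])
    then obtain M G G2 \<kappa> d where
      g: "jet2 M (\<lambda>q. \<Theta> (?\<sigma> q)) G G2" and M: "M = {q. ?\<sigma> q \<in> W'}"
      and cont: "continuous_on M \<kappa>" "continuous_on M d" and \<kappa>0: "\<kappa> (0,0) \<noteq> 0"
      and gram_g: "\<And>q. q \<in> M \<Longrightarrow> gram (G q (1,0)) (G q (0,1)) = (snd q)\<^sup>2 * d q"
      and H_g: "\<And>q. q \<in> M \<Longrightarrow> H_numerator (G q (1,0)) (G q (0,1))
        (G2 q (1,0) (1,0)) (G2 q (1,0) (0,1)) (G2 q (0,1) (0,1))
        = (snd q)\<^sup>2 * \<kappa> q"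
      by (rule cuspidal_model_expansion[OF \<Theta> 0 det]) (rule that)
    have \<phi>M: "\<phi> p \<in> M" if "p \<in> V" for p using W'(1)[OF that] model[OF that] M by simp
    define F where "F = (\<lambda>x v. G (\<phi> x) (P x v))"
    define F2 where "F2 = (\<lambda>x v w. G2 (\<phi> x) (P x v) (P x w) + G (\<phi> x) (P2 x v w))"
    have f: "jet2 V f F F2"
      unfolding F_def F2_def
      by (rule jet2_cong[OF jet2_chain[OF \<phi> g \<phi>M]]) (simp_all add: model[symmetric] W')
    let ?H = "\<lambda>p. H_numerator (F p (1,0)) (F p (0,1))
      (F2 p (1,0) (1,0)) (F2 p (1,0) (0,1)) (F2 p (0,1) (0,1))"
    let ?v = "\<lambda>p. snd (\<phi> p)"
    have gram_f: "gram (F p (1,0)) (F p (0,1)) = (J p * ?v p)\<^sup>2 * d (\<phi> p)" if "p \<in> V" for p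
      using gram_H_numerator_reparametrize(1)[OF g \<phi>M[OF that] F_def F2_def, of "J p"] gram_g[OF \<phi>M[OF that]]
      by (simp add: J_def power_mult_distrib)
    have H_f: "?H p = J p * (J p * ?v p)\<^sup>2 * \<kappa> (\<phi> p)" if "p \<in> V" for p
      using gram_H_numerator_reparametrize(2)[OF g \<phi>M[OF that] F_def F2_def, of "J p"] H_g[OF \<phi>M[OF that]]
      by (simp add: J_def power2_eq_square power3_eq_cube)
    obtain B where B0: "B > 0" and B: "\<And>p. p \<in> U \<Longrightarrow> snd p \<noteq> 0 \<Longrightarrow> regular_point f p \<Longrightarrow> Delta_L f p \<noteq> 0
        \<Longrightarrow> \<bar>mean_curvature_L f p\<bar> \<le> B"
      using bounded unfolding mean_curvature_L_bounded_on_def bounded_pos by auto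
    \<comment> \<open>At points where \<open>H\<^sup>L\<close> is defined, \<open>\<bar>H\<^sup>L\<bar> \<le> B\<close> says exactly that \<open>r\<close> is not positive.\<close>
    define r where "r = (\<lambda>q. \<bar>\<kappa> q\<bar> - 2 * B * \<bar>snd q\<bar> * (\<bar>d q\<bar> * sqrt \<bar>d q\<bar>))"
    have r0: "r (\<phi> p0) > 0" using \<kappa>0 by (simp add: r_def \<phi>0)
    have "continuous_on M r" unfolding r_def by (intro continuous_intros cont)
    then have cr: "continuous_on V (\<lambda>p. r (\<phi> p))"
      by (rule continuous_on_compose2[OF _ jet2_continuous[OF \<phi>]]) (use \<phi>M in auto)
    have cE: "continuous_on V (\<lambda>p. lorentz (F p (1,0)) (F p (1,0)))"
      by (intro continuous_on_lorentz jet2_continuous1[OF f])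
    have F0: "F p0 (1,0) = ?a *\<^sub>R T 0 axis1"
      using has_derivative_unique[OF jet2_has_derivative[OF f p0] d0] by simp
    define N where "N = {p \<in> V. r (\<phi> p) > 0} \<inter> {p \<in> V. lorentz (F p (1,0)) (F p (1,0)) \<noteq> 0}"
    have oN: "open N" unfolding N_def
      by (intro open_Int) (use continuous_open_preimage[OF cr jet2_open[OF \<phi>], of "{0<..}"]
         continuous_open_preimage[OF cE jet2_open[OF \<phi>], of "- {0}"]
         in \<open>simp_all add: open_Compl vimage_def Int_def\<close>)
    have NV: "N \<subseteq> V" by (auto simp: N_def)
    have p0N: "p0 \<in> N" using p0 r0 nz by (simp add: N_def F0)
    have "\<exists>p\<in>N. ?v p \<noteq> 0"
    proof -
      let ?A = "V' \<inter> \<psi> -` N"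
      have "open ?A" using continuous_open_preimage[OF jet2_continuous[OF \<psi>] jet2_open[OF \<psi>] oN] .
      moreover have "(0,0) \<in> ?A"
        using p0 p0N \<phi>0 h\<phi> unfolding homeomorphism_def by (metis IntI image_eqI vimageI)
      ultimately obtain q where "q \<in> ?A" "snd q \<noteq> 0" using open_meets_off_axis[of ?A] by blast
      then show ?thesis using h\<phi> by (intro bexI[of _ "\<psi> q"]) (auto simp: homeomorphism_def)
    qed
    then have ne: "N \<inter> {p \<in> V. ?v p \<noteq> 0} \<noteq> {}" using NV by auto
    have cv: "continuous_on V (\<lambda>p. ?v p)"
      by (intro continuous_intros jet2_continuous[OF \<phi>])
    have oNv: "open (N \<inter> {p \<in> V. ?v p \<noteq> 0})"
      using continuous_open_preimage[OF cv jet2_open[OF \<phi>], of "- {0}"]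
      by (intro open_Int oN) (simp add: open_Compl vimage_def Int_def)
    obtain p1 where p1: "p1 \<in> N" "?v p1 \<noteq> 0" "snd p1 \<noteq> 0"
      using open_meets_off_axis[OF oNv ne] by blast
    define N' where "N' = (N \<inter> {p \<in> V. ?v p \<noteq> 0}) \<inter> {p. snd p \<noteq> 0}"
    have oN': "open N'"
    proof -
      have "open {p :: real \<times> real. snd p \<noteq> 0}" by (intro open_Collect_neq continuous_intros)
      with oNv show ?thesis unfolding N'_def by (rule open_Int)
    qed
    have N'V: "N' \<subseteq> V" using NV by (auto simp: N'_def)
    have p1': "p1 \<in> N'" using p1 NV by (auto simp: N'_def)
    \<comment> \<open>Otherwise the surface would be null on \<open>N'\<close>, which forces \<open>\<kappa> = 0\<close> there.\<close>
    have "\<exists>p\<in>N'. gram (F p (1,0)) (F p (0,1)) \<noteq> 0"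
    proof (rule ccontr)
      assume "\<not> ?thesis"
      then have "?H p1 = 0"
        using p1 by (intro null_surface_H_numerator[OF jet2_subset[OF f oN' N'V] p1']) (auto simp: N_def)
      moreover have "\<kappa> (\<phi> p1) \<noteq> 0"
      proof
        assume "\<kappa> (\<phi> p1) = 0"
        moreover have "0 \<le> 2 * B * \<bar>?v p1\<bar> * (\<bar>d (\<phi> p1)\<bar> * sqrt \<bar>d (\<phi> p1)\<bar>)" using B0 by simp
        ultimately show False using p1(1) by (simp add: N_def r_def)
      qed
      ultimately show False using H_f[of p1] J[of p1] p1 NV by auto
    qed
    then obtain p where pN: "p \<in> N'" and gp: "gram (F p (1,0)) (F p (0,1)) \<noteq> 0" by blast
    have p: "p \<in> V" "r (\<phi> p) > 0" "?v p \<noteq> 0" "snd p \<noteq> 0" using pN by (auto simp: N'_def N_def)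
    note geo = geometry_of_jet2[OF f p(1)]
    have "\<bar>mean_curvature_L f p\<bar> \<le> B"
      using B[of p] geo(1,3) gp p VU by auto
    define c where "c = \<bar>J p * ?v p\<bar>"
    have c: "c > 0" using J[OF p(1)] p(3) by (simp add: c_def)
    define \<Delta> where "\<Delta> = \<bar>d (\<phi> p)\<bar>"
    have D: "\<bar>Delta_L f p\<bar> = c\<^sup>2 * \<Delta>"
      unfolding geo(1) gram_f[OF p(1)] c_def \<Delta>_def by (subst abs_mult) simp
    have "\<Delta> > 0" using gp gram_f[OF p(1)] by (auto simp: \<Delta>_def)
    have root: "sqrt \<bar>Delta_L f p\<bar> = c * sqrt \<Delta>"
      unfolding D using c by (simp add: real_sqrt_mult)
    have num: "\<bar>?H p\<bar> = \<bar>J p\<bar> * c\<^sup>2 * \<bar>\<kappa> (\<phi> p)\<bar>"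
      unfolding H_f[OF p(1)] c_def by (simp add: abs_mult power_mult_distrib)
    have "\<bar>mean_curvature_L f p\<bar> = \<bar>?H p\<bar> / (2 * \<bar>Delta_L f p\<bar> * sqrt \<bar>Delta_L f p\<bar>)"
      unfolding geo(2) by (simp add: abs_mult)
    also have "\<dots> = \<bar>J p\<bar> * c\<^sup>2 * \<bar>\<kappa> (\<phi> p)\<bar> / (2 * (c\<^sup>2 * \<Delta>) * (c * sqrt \<Delta>))"
      unfolding root num unfolding D ..
    also have "\<dots> = \<bar>\<kappa> (\<phi> p)\<bar> / (2 * \<bar>?v p\<bar> * (\<Delta> * sqrt \<Delta>))"
      using J[OF p(1)] p(3) \<open>\<Delta> > 0\<close> by (simp add: c_def abs_mult power_mult_distrib field_simps)
    finally have "\<bar>\<kappa> (\<phi> p)\<bar> \<le> B * (2 * \<bar>?v p\<bar> * (\<Delta> * sqrt \<Delta>))"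
      using \<open>\<bar>mean_curvature_L f p\<bar> \<le> B\<close> \<open>\<Delta> > 0\<close> p(3) by (simp add: pos_divide_le_eq)
    with p(2) show False by (simp add: r_def \<Delta>_def algebra_simps)
  qed
  with d0 show ?thesis by (intro that[of "\<lambda>v. fst (P p0 v) *\<^sub>R T 0 axis1"]) auto
qed

theorem corollaryB:
  fixes I :: "real set" and \<delta> :: real
    and f :: "real \<times> real \<Rightarrow> real^3" and \<Gamma> :: "real \<Rightarrow> real^3"
  assumes "open I" and "is_interval I" and "I \<noteq> {}" and "\<delta> > 0"
    and "cuspidal_edge_along I \<delta> f \<Gamma>"
    and "mean_curvature_L_bounded_on f (strip I \<delta> - sing_axis I)"
  shows "type_L_on I \<Gamma>"
  unfolding type_L_on_def light_like_def
proof
  fix s assume s: "s \<in> I"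
  have edge: "\<And>x. x \<in> I \<Longrightarrow> f (x, 0) = \<Gamma> x" "vector_derivative \<Gamma> (at s) \<noteq> 0"
    "cuspidal_edge_point (strip I \<delta>) f (s, 0)"
    using assms(5) s by (auto simp: cuspidal_edge_along_def regular_curve_on_def)
  have "strip I \<delta> - sing_axis I = {p \<in> strip I \<delta>. snd p \<noteq> 0}"
    by (auto simp: strip_def sing_axis_def)
  with assms(6) obtain D where D: "(f has_derivative D) (at (s, 0))"
    and null: "lorentz (D (1,0)) (D (1,0)) = 0"
    using null_direction_at_cuspidal_edge_point[OF edge(3)] by auto
  have "((\<lambda>x. (x, 0)) has_derivative (\<lambda>h. (h, 0))) (at s)"
    by (auto intro!: derivative_eq_intros)
  then have "((\<lambda>x. f (x, 0)) has_derivative (\<lambda>h. D (h, 0))) (at s)"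
    by (rule has_derivative_compose[where g = f and f = "\<lambda>x. (x, 0)", OF _ D])
  moreover have "(\<lambda>h. D (h, 0)) = (\<lambda>h. h *\<^sub>R D (1, 0))"
    by (simp add: fun_eq_iff linear_cmul[OF has_derivative_linear[OF D], symmetric])
  ultimately have "((\<lambda>x. f (x, 0)) has_vector_derivative D (1,0)) (at s)"
    by (simp add: has_vector_derivative_def)
  then have "(\<Gamma> has_vector_derivative D (1,0)) (at s)"
    by (rule has_vector_derivative_transform_within_open[OF _ assms(1) s]) (simp add: edge)
  then have "vector_derivative \<Gamma> (at s) = D (1,0)" by (rule vector_derivative_at)
  with edge(2) null
  show "vector_derivative \<Gamma> (at s) \<noteq> 0 \<and> lorentz (vector_derivative \<Gamma> (at s)) (vector_derivative \<Gamma> (at s)) = 0"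
    by simp
qed

end
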